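(* Let $l\ge1$, $n\ge1$, $m\ge0$ and $k\ge1$ be integers, and consider a moving curvilinear space-time element with non-singular map $x,y\in\mathbb{Q}^l(\xi,\eta)\otimes P^n(\tau)$, $t\in P^n(\tau)$. Consider on it the space-time flux reconstruction scheme in reference form $$\frac{\partial(|J|\boldsymbol Q_h)}{\partial\widetilde t}+\frac{\partial\widetilde{\boldsymbol Q}^{\rm loc}}{\partial\tau}+\frac{\partial\widetilde{\boldsymbol F}^{\rm loc}}{\partial\xi}+\frac{\partial\widetilde{\boldsymbol G}^{\rm loc}}{\partial\eta}+\widetilde{\boldsymbol\delta}^{\rm cor,st}=0\qquad(\mathrm R)$$ with the solution, flux and correction field polynomial degrees listed in the context. Then: (1) the scheme numerically satisfies (in the sense defined in the context) the geometric conservation law $$\frac{\partial}{\partial\tau}\begin{pmatrix}|J|\tau_t\\|J|\tau_x\\|J|\tau_y\end{pmatrix}+\frac{\partial}{\partial\xi}\begin{pmatrix}|J|\xi_t\\|J|\xi_x\\|J|\xi_y\end{pmatrix}+\frac{\partial}{\partial\eta}\begin{pmatrix}|J|\eta_t\\|J|\eta_x\\|J|\eta_y\end{pmatrix}=0,$$ no matter whether the metrics are calculated with the non-conservative or with the conservative formulas; (2) the scheme (R) is numerically equivalent (in the sense defined in the context) to the physical-domain form $$\frac{\partial\boldsymbol Q_h}{\partial\widetilde t}+\frac{\partial\boldsymbol Q^{\rm loc}}{\partial t}+\frac{\partial\boldsymbol F^{\rm loc}}{\partial x}+\frac{\partial\boldsymbol G^{\rm loc}}{\partial y}+\boldsymbol\delta^{\rm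 cor,st}=0.\qquad(\mathrm P)$$
   Context: **Spaces.** $P^a$ denotes univariate polynomials of degree at most $a$; $\mathbb{Q}^a(\xi,\eta)=P^a(\xi)\otimes P^a(\eta)$. Reference coordinates are $(\tau,\xi,\eta)\in[-1,1]^3$; physical coordinates are $(t,x,y)$; $\widetilde t$ is a pseudo-time on which the geometry does not depend. **Equations and metrics.** The conservation law is $\partial_t\boldsymbol Q+\partial_x\boldsymbol F(\boldsymbol Q)+\partial_y\boldsymbol G(\boldsymbol Q)=0$, with vectors in $\mathbb{R}^{N_v}$. In the space-time slab setting $t=t(\tau)$, so $t_\xi=t_\eta=0$ and $\tau_x=\tau_y=0$. $J=\partial(t,x,y)/\partial(\tau,\xi,\eta)$, $|J|=\det J=t_\tau(x_\xi y_\eta-x_\eta y_\xi)\ne0$, and $\tau_t,\dots,\eta_y$ are the entries of $J^{-1}$. The non-conservative metric formulas are $$|J|\tau_t=x_\xi y_\eta-x_\eta y_\xi,\quad |J|\tau_x=|J|\tau_y=0,\quad |J|\xi_t=-x_\tau y_\eta+y_\tau x_\eta,\quad |J|\xi_x=t_\tau y_\eta,\quad |J|\xi_y=-t_\tau x_\eta,$$ $$|J|\eta_t=x_\tau y_\xi-y_\tau x_\xi,\quad |J|\eta_x=-t_\tau y_\xi,\quad |J|\eta_y=t_\tau x_\xi.$$ The conservative formulas are the algebraically equivalent (symmetric) curl forms, e.g. $|J|\tau_t=\tfrac12[(x_\xi y)_\eta-(x_\eta y)_\xi+(xy_\eta)_\xi-(xy_\xi)_\eta]$, and similarly for the others. In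 both cases the metrics are the exact polynomials, not approximated further. The transformed fluxes are $$\widetilde{\boldsymbol Q}=|J|\tau_t\boldsymbol Q,\quad\widetilde{\boldsymbol F}=|J|\xi_t\boldsymbol Q+|J|\xi_x\boldsymbol F+|J|\xi_y\boldsymbol G,\quad\widetilde{\boldsymbol G}=|J|\eta_t\boldsymbol Q+|J|\eta_x\boldsymbol F+|J|\eta_y\boldsymbol G,$$ and the local transformed fluxes $\widetilde{\boldsymbol Q}^{\rm loc},\widetilde{\boldsymbol F}^{\rm loc},\widetilde{\boldsymbol G}^{\rm loc}$ are given by these formulas applied to $\boldsymbol Q^{\rm loc},\boldsymbol F^{\rm loc},\boldsymbol G^{\rm loc}$ (the solution and metrics are approximated by separate polynomials). **Polynomial degrees.** Componentwise: - $\boldsymbol Q_h\in\mathbb{Q}^k(\xi,\eta)\otimes P^m(\tau)$, $|J|\boldsymbol Q_h\in\mathbb{Q}^{k+2l-1}\otimes P^{m+3n-1}$; - $\boldsymbol Q^{\rm loc}\in\mathbb{Q}^k\otimes P^{m+n}$; $\boldsymbol F^{\rm loc},\boldsymbol G^{\rm loc}\in\mathbb{Q}^{k+l}\otimes P^{m+n}$; - $\widetilde{\boldsymbol Q}^{\rm loc},\widetilde{\boldsymbol Q}^{\rm cor}\in\mathbb{Q}^{k+2l-1}\otimes P^{m+3n}$; - $\widetilde{\boldsymbol F}^{\rm loc},\widetilde{\boldsymbol F}^{\rm cor}\in P^{k+2l}(\xi)\otimes P^{k+2l-1}(\eta)\otimes P^{m+3n-1}(\tau)$; - $\widetilde{\boldsymbol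 G}^{\rm loc},\widetilde{\boldsymbol G}^{\rm cor}\in P^{k+2l-1}(\xi)\otimes P^{k+2l}(\eta)\otimes P^{m+3n-1}(\tau)$; - $\widetilde{\boldsymbol\delta}^{\rm cor,st}\in\mathbb{Q}^{k+2l-1}\otimes P^{m+3n-1}$ (with $\boldsymbol\delta^{\rm cor,st}$ nominally in $\mathbb{Q}^k\otimes P^m$). **Scheme.** The solution points form the tensor grid of $k+2l$ Gauss--Legendre points in each of $\xi,\eta$ and $m+3n$ Gauss--Legendre points in $\tau$, with tensor Lagrange basis $w_j^r\in\mathbb{Q}^{k+2l-1}(\xi,\eta)\otimes P^{m+3n-1}(\tau)$. SP denotes values at solution points. The correction field is $\widetilde{\boldsymbol\delta}^{\rm cor,st}=\partial_\tau\widetilde{\boldsymbol Q}^{\rm cor}+\partial_\xi\widetilde{\boldsymbol F}^{\rm cor}+\partial_\eta\widetilde{\boldsymbol G}^{\rm cor}$, with $$\widetilde{\boldsymbol Q}^{\rm cor}=\big(\widetilde{\boldsymbol Q}^{\rm num}_L(\xi,\eta)-\widetilde{\boldsymbol Q}^{\rm loc}(-1,\xi,\eta)\big)g_L(\tau)+\big(\widetilde{\boldsymbol Q}^{\rm num}_R(\xi,\eta)-\widetilde{\boldsymbol Q}^{\rm loc}(1,\xi,\eta)\big)g_R(\tau)$$ and analogous formulas for $\widetilde{\boldsymbol F}^{\rm cor}$ (faces $\xi=\mp1$, functions $g_{L/R}(\xi)$) and $\widetilde{\boldsymbol G}^{\rm cor}$ (faces $\eta=\mp1$, functions $g_{L/R}(\eta)$).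 Here $g_L,g_R$ are the right and left Radau polynomials, of degree $m+3n$ in $\tau$ and $k+2l$ in $\xi,\eta$, with $g_L(-1)=g_R(1)=1$, $g_L(1)=g_R(-1)=0$. With $\nabla^{\rm st}=(\partial_t,\partial_x,\partial_y)$, the numerical fluxes are $|J|\,\|\nabla^{\rm st}\zeta\|_2\,\mathrm{sign}(\boldsymbol n^{\rm st}\cdot\nabla^{\rm st}\zeta)\,\boldsymbol F_n^{\rm st,com}$ with $\zeta=\tau,\xi,\eta$ for $\widetilde{\boldsymbol Q}^{\rm num},\widetilde{\boldsymbol F}^{\rm num},\widetilde{\boldsymbol G}^{\rm num}$, evaluated with exact metrics at flux points (intersections of the element boundary with coordinate lines through solution points); $\boldsymbol n^{\rm st}$ is the outward unit space-time normal in the physical domain, and $\boldsymbol F_n^{\rm st,com}$ is the common normal flux (local Lax--Friedrichs), equal to $\boldsymbol n^{\rm st}\cdot(\boldsymbol Q,\boldsymbol F,\boldsymbol G)$ when the two neighbouring states agree. **Meaning of "numerically satisfies the GCL".** In a freestream ($\boldsymbol Q$ constant in all elements, hence $\boldsymbol F,\boldsymbol G$ constant), the local transformed fluxes are represented by their nodal values, e.g. $\widetilde{\boldsymbol F}^{\rm loc}=\sum_j(|J|\xi_t\boldsymbol Q+|J|\xi_x\boldsymbol F+|J|\xi_y\boldsymbol G)^{\rm SP}_jw_j^r$. The scheme numerically satisfies the GCL if (a) for each $*\in\{t,x,y\}$, $$\sum_j(|J|\tau_* )_j^{\rm SP}\frac{\partial w_j^r}{\partial\tau}+\sum_j(|J|\xi_*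 )_j^{\rm SP}\frac{\partial w_j^r}{\partial\xi}+\sum_j(|J|\eta_* )_j^{\rm SP}\frac{\partial w_j^r}{\partial\eta}=0,$$ and (b) for every freestream $\partial_\tau\widetilde{\boldsymbol Q}^{\rm loc}+\partial_\xi\widetilde{\boldsymbol F}^{\rm loc}+\partial_\eta\widetilde{\boldsymbol G}^{\rm loc}+\widetilde{\boldsymbol\delta}^{\rm cor,st}=0$. **Meaning of "numerically equivalent".** In (P), the derivatives are evaluated at solution points by the chain rule applied to the polynomials in reference coordinates, $$\frac{\partial\boldsymbol Q^{\rm loc}}{\partial t}=\frac{\partial\boldsymbol Q^{\rm loc}}{\partial\tau}\tau_t+\frac{\partial\boldsymbol Q^{\rm loc}}{\partial\xi}\xi_t+\frac{\partial\boldsymbol Q^{\rm loc}}{\partial\eta}\eta_t,\quad \frac{\partial\boldsymbol F^{\rm loc}}{\partial x}=\frac{\partial\boldsymbol F^{\rm loc}}{\partial\xi}\xi_x+\frac{\partial\boldsymbol F^{\rm loc}}{\partial\eta}\eta_x,\quad \frac{\partial\boldsymbol G^{\rm loc}}{\partial y}=\frac{\partial\boldsymbol G^{\rm loc}}{\partial\xi}\xi_y+\frac{\partial\boldsymbol G^{\rm loc}}{\partial\eta}\eta_y,$$ and $\boldsymbol\delta^{\rm cor,st}=\widetilde{\boldsymbol\delta}^{\rm cor,st}/|J|$ there. Numerical equivalence means that at every solution point the left-hand side of (R) equals $|J|$ times the left-hand side of (P); in particular $$|J|\Big(\frac{\partial\boldsymbol Q^{\rm loc}}{\partial t}+\frac{\partial\boldsymbol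 F^{\rm loc}}{\partial x}+\frac{\partial\boldsymbol G^{\rm loc}}{\partial y}\Big)=\frac{\partial\widetilde{\boldsymbol Q}^{\rm loc}}{\partial\tau}+\frac{\partial\widetilde{\boldsymbol F}^{\rm loc}}{\partial\xi}+\frac{\partial\widetilde{\boldsymbol G}^{\rm loc}}{\partial\eta}.$$ Exact arithmetic is assumed (machine round-off is neglected). *)

theory Defs
  imports "HOL-Analysis.Analysis" "HOL-Computational_Algebra.Polynomial"
begin

text \<open>
  Reference points are vectors in \<^typ>\<open>real^3\<close> with coordinates 1, 2, 3 standing for
  \<open>\<tau>\<close>, \<open>\<xi>\<close>, \<open>\<eta>\<close>; physical points have coordinates 1, 2, 3 standing for \<open>t\<close>, \<open>x\<close>, \<open>y\<close>.
\<close>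

subsection \<open>Tensor-product polynomials and partial derivatives\<close>

definition set_coord :: "3 \<Rightarrow> real \<Rightarrow> real^3 \<Rightarrow> real^3" where
  "set_coord b s r = (\<chi> c. if c = b then s else r $ c)"

definition partial_deriv :: "3 \<Rightarrow> (real^3 \<Rightarrow> 'a::real_normed_vector) \<Rightarrow> real^3 \<Rightarrow> 'a" where
  "partial_deriv b f r = vector_derivative (\<lambda>s. f (set_coord b s r)) (at (r $ b))"

abbreviation d_tau :: "(real^3 \<Rightarrow> 'a::real_normed_vector) \<Rightarrow> real^3 \<Rightarrow> 'a" where
  "d_tau \<equiv> partial_deriv 1"

abbreviation d_xi :: "(real^3 \<Rightarrow> 'a::real_normed_vector) \<Rightarrow> real^3 \<Rightarrow> 'a" where
  "d_xi \<equiv> partial_deriv 2"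

abbreviation d_eta :: "(real^3 \<Rightarrow> 'a::real_normed_vector) \<Rightarrow> real^3 \<Rightarrow> 'a" where
  "d_eta \<equiv> partial_deriv 3"

text \<open>The space \<open>P\<^sup>a(\<tau>) \<otimes> P\<^sup>b(\<xi>) \<otimes> P\<^sup>c(\<eta>)\<close>, with scalar or vector coefficients.\<close>

definition tensor_poly :: "nat \<Rightarrow> nat \<Rightarrow> nat \<Rightarrow> (real^3 \<Rightarrow> 'a::real_normed_vector) \<Rightarrow> bool" where
  "tensor_poly a b c f \<longleftrightarrow>
     (\<exists>C. \<forall>r. f r = (\<Sum>i\<le>a. \<Sum>j\<le>b. \<Sum>k\<le>c. (r $ 1 ^ i * r $ 2 ^ j * r $ 3 ^ k) *\<^sub>R C i j k))"


subsection \<open>Geometry\<close>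

definition ref_cube :: "(real^3) set" where
  "ref_cube = {r. \<forall>c. -1 \<le> r $ c \<and> r $ c \<le> 1}"

text \<open>Rows are indexed by \<open>t, x, y\<close> and columns by \<open>\<tau>, \<xi>, \<eta>\<close>; for the inverse it is the other
  way round, so that row \<open>b\<close> of the inverse is the space-time gradient of the reference
  coordinate \<open>b\<close>.\<close>

definition jacobian :: "(real^3 \<Rightarrow> real^3) \<Rightarrow> real^3 \<Rightarrow> real^3^3" where
  "jacobian X r = (\<chi> a b. partial_deriv b (\<lambda>p. X p $ a) r)"

definition inv_jacobian :: "(real^3 \<Rightarrow> real^3) \<Rightarrow> real^3 \<Rightarrow> real^3^3" where
  "inv_jacobian X r = matrix_inv (jacobian X r)"

definition slab_element :: "nat \<Rightarrow> nat \<Rightarrow> (real^3 \<Rightarrow> real^3) \<Rightarrow> bool" where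
  "slab_element l n X \<longleftrightarrow>
     tensor_poly n 0 0 (\<lambda>r. X r $ 1) \<and>
     tensor_poly n l l (\<lambda>r. X r $ 2) \<and>
     tensor_poly n l l (\<lambda>r. X r $ 3) \<and>
     (\<forall>r\<in>ref_cube. det (jacobian X r) \<noteq> 0)"

text \<open>The entry in row \<open>b\<close> and column \<open>a\<close> of a metric matrix is \<open>det J\<close> times the derivative of
  the reference coordinate \<open>b\<close> with respect to the physical coordinate \<open>a\<close>.\<close>

definition nonconservative_metrics :: "(real^3 \<Rightarrow> real^3) \<Rightarrow> real^3 \<Rightarrow> real^3^3" where
  "nonconservative_metrics X r =
     (let t = (\<lambda>p. X p $ 1); x = (\<lambda>p. X p $ 2); y = (\<lambda>p. X p $ 3) in
      vector
       [vector [d_xi x r * d_eta y r - d_eta x r * d_xi y r, 0, 0],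
        vector [- d_tau x r * d_eta y r + d_tau y r * d_eta x r,
                d_tau t r * d_eta y r,
                - d_tau t r * d_eta x r],
        vector [d_tau x r * d_xi y r - d_tau y r * d_xi x r,
                - d_tau t r * d_xi y r,
                d_tau t r * d_xi x r]])"

text \<open>The symmetric curl form of \<open>u\<^sub>a v\<^sub>b - u\<^sub>b v\<^sub>a\<close>; the subscripts denote partial derivatives.\<close>

definition curl_form :: "3 \<Rightarrow> 3 \<Rightarrow> (real^3 \<Rightarrow> real) \<Rightarrow> (real^3 \<Rightarrow> real) \<Rightarrow> real^3 \<Rightarrow> real" where
  "curl_form a b u v r =
     (partial_deriv b (\<lambda>p. partial_deriv a u p * v p) r
      - partial_deriv a (\<lambda>p. partial_deriv b u p * v p) r
      + partial_deriv a (\<lambda>p. u p * partial_deriv b v p) r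
      - partial_deriv b (\<lambda>p. u p * partial_deriv a v p) r) / 2"

text \<open>All nine entries arise from the first one by cyclic permutation of \<open>\<tau>, \<xi>, \<eta>\<close> and of
  \<open>t, x, y\<close>.\<close>

definition conservative_metrics :: "(real^3 \<Rightarrow> real^3) \<Rightarrow> real^3 \<Rightarrow> real^3^3" where
  "conservative_metrics X r =
     (let t = (\<lambda>p. X p $ 1); x = (\<lambda>p. X p $ 2); y = (\<lambda>p. X p $ 3) in
      vector
       [vector [curl_form 2 3 x y r, curl_form 2 3 y t r, curl_form 2 3 t x r],
        vector [curl_form 3 1 x y r, curl_form 3 1 y t r, curl_form 3 1 t x r],
        vector [curl_form 1 2 x y r, curl_form 1 2 y t r, curl_form 1 2 t x r]])"

text \<open>The outward unit normal of the physical image of the face \<open>r $ b = \<sigma>\<close> with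
  \<open>\<sigma> \<in> {-1, 1}\<close>: the columns of the Jacobian other than \<open>b\<close> span the tangent plane, and
  \<open>\<sigma>\<close> times column \<open>b\<close> points out of the element whatever the sign of the determinant.\<close>

definition outward_normal :: "(real^3 \<Rightarrow> real^3) \<Rightarrow> 3 \<Rightarrow> real \<Rightarrow> real^3 \<Rightarrow> real^3" where
  "outward_normal X b \<sigma> r =
     (THE \<nu>. norm \<nu> = 1 \<and> (\<forall>c. c \<noteq> b \<longrightarrow> \<nu> \<bullet> column c (jacobian X r) = 0) \<and>
          \<nu> \<bullet> (\<sigma> *\<^sub>R column b (jacobian X r)) > 0)"


subsection \<open>Gauss--Legendre nodes, Lagrange bases and Radau polynomials\<close>

definition legendre_poly :: "nat \<Rightarrow> real poly" where
  "legendre_poly N = smult (1 / (2 ^ N * fact N)) ((pderiv ^^ N) ([:-1, 0, 1:] ^ N))"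

definition gauss_points :: "nat \<Rightarrow> real set" where
  "gauss_points N = {s. poly (legendre_poly N) s = 0}"

definition lagrange_basis :: "real set \<Rightarrow> real \<Rightarrow> real \<Rightarrow> real" where
  "lagrange_basis S p z = (\<Prod>q\<in>S - {p}. (z - q) / (p - q))"

text \<open>\<open>radau_L\<close> is the right Radau polynomial (equal to 1 at -1 and to 0 at 1), \<open>radau_R\<close> the left
  Radau polynomial, both of degree \<open>N \<ge> 1\<close>.\<close>

definition radau_L :: "nat \<Rightarrow> real \<Rightarrow> real" where
  "radau_L N z = (-1) ^ N / 2 * (poly (legendre_poly N) z - poly (legendre_poly (N - 1)) z)"

definition radau_R :: "nat \<Rightarrow> real \<Rightarrow> real" where
  "radau_R N z = (poly (legendre_poly N) z + poly (legendre_poly (N - 1)) z) / 2"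

text \<open>In what follows \<open>N b\<close> is the number of solution points in the reference direction \<open>b\<close>.
  Nodes serve as their own indices.\<close>

definition num_points :: "nat \<Rightarrow> nat \<Rightarrow> nat \<Rightarrow> nat \<Rightarrow> 3 \<Rightarrow> nat" where
  "num_points k l m n b = (if b = 1 then m + 3 * n else k + 2 * l)"

definition sol_points :: "(3 \<Rightarrow> nat) \<Rightarrow> (real^3) set" where
  "sol_points N = {p. \<forall>c. p $ c \<in> gauss_points (N c)}"

definition nodal_basis :: "(3 \<Rightarrow> nat) \<Rightarrow> real^3 \<Rightarrow> real^3 \<Rightarrow> real" where
  "nodal_basis N p r = (\<Prod>c\<in>UNIV. lagrange_basis (gauss_points (N c)) (p $ c) (r $ c))"

definition nodal_interp ::
    "(3 \<Rightarrow> nat) \<Rightarrow> (real^3 \<Rightarrow> 'a::real_normed_vector) \<Rightarrow> real^3 \<Rightarrow> 'a" where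
  "nodal_interp N u r = (\<Sum>p\<in>sol_points N. nodal_basis N p r *\<^sub>R u p)"

definition flux_points :: "(3 \<Rightarrow> nat) \<Rightarrow> 3 \<Rightarrow> real \<Rightarrow> (real^3) set" where
  "flux_points N b \<sigma> = {p. p $ b = \<sigma> \<and> (\<forall>c. c \<noteq> b \<longrightarrow> p $ c \<in> gauss_points (N c))}"

definition face_interp ::
    "(3 \<Rightarrow> nat) \<Rightarrow> 3 \<Rightarrow> real \<Rightarrow> (real^3 \<Rightarrow> 'a::real_normed_vector) \<Rightarrow> real^3 \<Rightarrow> 'a" where
  "face_interp N b \<sigma> u r =
     (\<Sum>p\<in>flux_points N b \<sigma>.
        (\<Prod>c\<in>UNIV - {b}. lagrange_basis (gauss_points (N c)) (p $ c) (r $ c)) *\<^sub>R u p)"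


subsection \<open>Fluxes and correction field\<close>

text \<open>For \<open>b = 1, 2, 3\<close> this is the transformed flux in direction \<open>\<tau>\<close>, \<open>\<xi>\<close>, \<open>\<eta>\<close>; \<open>M\<close> is a matrix
  of metrics as above.\<close>

definition transformed_flux ::
    "(real^3 \<Rightarrow> real^3^3) \<Rightarrow> (real^3 \<Rightarrow> real^'v) \<Rightarrow> (real^3 \<Rightarrow> real^'v) \<Rightarrow> (real^3 \<Rightarrow> real^'v) \<Rightarrow>
     3 \<Rightarrow> real^3 \<Rightarrow> real^'v" where
  "transformed_flux M Q F G b r =
     (if b = 1 then M r $ 1 $ 1 *\<^sub>R Q r
      else M r $ b $ 1 *\<^sub>R Q r + M r $ b $ 2 *\<^sub>R F r + M r $ b $ 3 *\<^sub>R G r)"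

definition normal_flux ::
    "(real^'v \<Rightarrow> real^'v) \<Rightarrow> (real^'v \<Rightarrow> real^'v) \<Rightarrow> real^3 \<Rightarrow> real^'v \<Rightarrow> real^'v" where
  "normal_flux F G \<nu> q = \<nu> $ 1 *\<^sub>R q + \<nu> $ 2 *\<^sub>R F q + \<nu> $ 3 *\<^sub>R G q"

text \<open>The local Lax--Friedrichs flux; \<open>speed\<close> is the wave-speed estimate, as a function of the
  normal, the interior state and the exterior state.\<close>

definition lax_friedrichs ::
    "(real^'v \<Rightarrow> real^'v) \<Rightarrow> (real^'v \<Rightarrow> real^'v) \<Rightarrow> (real^3 \<Rightarrow> real^'v \<Rightarrow> real^'v \<Rightarrow> real) \<Rightarrow>
     real^3 \<Rightarrow> real^'v \<Rightarrow> real^'v \<Rightarrow> real^'v" where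
  "lax_friedrichs F G speed \<nu> qi qe =
     (1/2) *\<^sub>R (normal_flux F G \<nu> qi + normal_flux F G \<nu> qe
               - speed \<nu> qi qe *\<^sub>R (qe - qi))"

definition numerical_flux ::
    "(real^3 \<Rightarrow> real^3) \<Rightarrow> (real^'v \<Rightarrow> real^'v) \<Rightarrow> (real^'v \<Rightarrow> real^'v) \<Rightarrow>
     (real^3 \<Rightarrow> real^'v \<Rightarrow> real^'v \<Rightarrow> real) \<Rightarrow>
     (real^3 \<Rightarrow> real^'v) \<Rightarrow> (3 \<Rightarrow> real \<Rightarrow> real^3 \<Rightarrow> real^'v) \<Rightarrow> 3 \<Rightarrow> real \<Rightarrow> real^3 \<Rightarrow> real^'v" where
  "numerical_flux X F G speed Qint Qext b \<sigma> p =
     (let grad = row b (inv_jacobian X p); \<nu> = outward_normal X b \<sigma> p in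
      (det (jacobian X p) * norm grad * sgn (\<nu> \<bullet> grad)) *\<^sub>R
        lax_friedrichs F G speed \<nu> (Qint p) (Qext b \<sigma> p))"

definition correction_flux ::
    "(3 \<Rightarrow> nat) \<Rightarrow> (3 \<Rightarrow> real^3 \<Rightarrow> real^'v) \<Rightarrow> (3 \<Rightarrow> real \<Rightarrow> real^3 \<Rightarrow> real^'v) \<Rightarrow>
     3 \<Rightarrow> real^3 \<Rightarrow> real^'v" where
  "correction_flux N H Hnum b r =
     radau_L (N b) (r $ b) *\<^sub>R
       (face_interp N b (-1) (Hnum b (-1)) r - H b (set_coord b (-1) r)) +
     radau_R (N b) (r $ b) *\<^sub>R
       (face_interp N b 1 (Hnum b 1) r - H b (set_coord b 1 r))"

definition divergence :: "(3 \<Rightarrow> real^3 \<Rightarrow> real^'v) \<Rightarrow> real^3 \<Rightarrow> real^'v" where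
  "divergence H r = d_tau (H 1) r + d_xi (H 2) r + d_eta (H 3) r"

definition correction_field ::
    "(3 \<Rightarrow> nat) \<Rightarrow> (3 \<Rightarrow> real^3 \<Rightarrow> real^'v) \<Rightarrow> (3 \<Rightarrow> real \<Rightarrow> real^3 \<Rightarrow> real^'v) \<Rightarrow>
     real^3 \<Rightarrow> real^'v" where
  "correction_field N H Hnum r = divergence (correction_flux N H Hnum) r"


subsection \<open>Geometric conservation law\<close>

text \<open>In a freestream with state \<open>q\<close>, the interior and all neighbouring states equal \<open>q\<close>, and the
  local transformed fluxes are the nodal interpolants of their values at solution points.\<close>

definition freestream_flux ::
    "(3 \<Rightarrow> nat) \<Rightarrow> (real^3 \<Rightarrow> real^3^3) \<Rightarrow> (real^'v \<Rightarrow> real^'v) \<Rightarrow> (real^'v \<Rightarrow> real^'v) \<Rightarrow>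
     real^'v \<Rightarrow> 3 \<Rightarrow> real^3 \<Rightarrow> real^'v" where
  "freestream_flux N M F G q b =
     nodal_interp N (transformed_flux M (\<lambda>_. q) (\<lambda>_. F q) (\<lambda>_. G q) b)"

definition numerically_satisfies_gcl ::
    "(3 \<Rightarrow> nat) \<Rightarrow> (real^3 \<Rightarrow> real^3) \<Rightarrow> (real^3 \<Rightarrow> real^3^3) \<Rightarrow>
     (real^'v \<Rightarrow> real^'v) \<Rightarrow> (real^'v \<Rightarrow> real^'v) \<Rightarrow>
     (real^3 \<Rightarrow> real^'v \<Rightarrow> real^'v \<Rightarrow> real) \<Rightarrow> bool" where
  "numerically_satisfies_gcl N X M F G speed \<longleftrightarrow>
     (\<forall>a r. (\<Sum>p\<in>sol_points N. M p $ 1 $ a * d_tau (nodal_basis N p) r) +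
            (\<Sum>p\<in>sol_points N. M p $ 2 $ a * d_xi (nodal_basis N p) r) +
            (\<Sum>p\<in>sol_points N. M p $ 3 $ a * d_eta (nodal_basis N p) r) = 0) \<and>
     (\<forall>q r. divergence (freestream_flux N M F G q) r +
            correction_field N (freestream_flux N M F G q)
              (numerical_flux X F G speed (\<lambda>_. q) (\<lambda>_ _ _. q)) r = 0)"


subsection \<open>Reference and physical forms of the scheme\<close>

text \<open>\<open>Qh\<close> depends on the pseudo-time; \<open>Q\<close>, \<open>F\<close>, \<open>G\<close> are the local polynomials and \<open>\<delta>\<close> is the
  correction field in reference form, all taken at the pseudo-time \<open>s\<close>.\<close>

definition reference_lhs ::
    "(real^3 \<Rightarrow> real^3) \<Rightarrow> (real^3 \<Rightarrow> real^3^3) \<Rightarrow> (real \<Rightarrow> real^3 \<Rightarrow> real^'v) \<Rightarrow>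
     (real^3 \<Rightarrow> real^'v) \<Rightarrow> (real^3 \<Rightarrow> real^'v) \<Rightarrow> (real^3 \<Rightarrow> real^'v) \<Rightarrow> (real^3 \<Rightarrow> real^'v) \<Rightarrow>
     real \<Rightarrow> real^3 \<Rightarrow> real^'v" where
  "reference_lhs X M Qh Q F G \<delta> s r =
     vector_derivative (\<lambda>s'. det (jacobian X r) *\<^sub>R Qh s' r) (at s) +
     divergence (transformed_flux M Q F G) r + \<delta> r"

definition physical_divergence ::
    "(real^3 \<Rightarrow> real^3) \<Rightarrow> (real^3 \<Rightarrow> real^'v) \<Rightarrow> (real^3 \<Rightarrow> real^'v) \<Rightarrow> (real^3 \<Rightarrow> real^'v) \<Rightarrow>
     real^3 \<Rightarrow> real^'v" where
  "physical_divergence X Q F G r =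
     (let K = inv_jacobian X r in
      (K $ 1 $ 1 *\<^sub>R d_tau Q r + K $ 2 $ 1 *\<^sub>R d_xi Q r + K $ 3 $ 1 *\<^sub>R d_eta Q r) +
      (K $ 2 $ 2 *\<^sub>R d_xi F r + K $ 3 $ 2 *\<^sub>R d_eta F r) +
      (K $ 2 $ 3 *\<^sub>R d_xi G r + K $ 3 $ 3 *\<^sub>R d_eta G r))"

definition physical_lhs ::
    "(real^3 \<Rightarrow> real^3) \<Rightarrow> (real \<Rightarrow> real^3 \<Rightarrow> real^'v) \<Rightarrow>
     (real^3 \<Rightarrow> real^'v) \<Rightarrow> (real^3 \<Rightarrow> real^'v) \<Rightarrow> (real^3 \<Rightarrow> real^'v) \<Rightarrow> (real^3 \<Rightarrow> real^'v) \<Rightarrow>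
     real \<Rightarrow> real^3 \<Rightarrow> real^'v" where
  "physical_lhs X Qh Q F G \<delta> s r =
     vector_derivative (\<lambda>s'. Qh s' r) (at s) +
     physical_divergence X Q F G r + (1 / det (jacobian X r)) *\<^sub>R \<delta> r"

definition numerically_equivalent ::
    "(3 \<Rightarrow> nat) \<Rightarrow> (real^3 \<Rightarrow> real^3) \<Rightarrow> (real^3 \<Rightarrow> real^3^3) \<Rightarrow> (real \<Rightarrow> real^3 \<Rightarrow> real^'v) \<Rightarrow>
     (real^3 \<Rightarrow> real^'v) \<Rightarrow> (real^3 \<Rightarrow> real^'v) \<Rightarrow> (real^3 \<Rightarrow> real^'v) \<Rightarrow> (real^3 \<Rightarrow> real^'v) \<Rightarrow>
     real \<Rightarrow> bool" where
  "numerically_equivalent N X M Qh Q F G \<delta> s \<longleftrightarrow>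
     (\<forall>r\<in>sol_points N.
        reference_lhs X M Qh Q F G \<delta> s r =
          det (jacobian X r) *\<^sub>R physical_lhs X Qh Q F G \<delta> s r \<and>
        det (jacobian X r) *\<^sub>R physical_divergence X Q F G r =
          divergence (transformed_flux M Q F G) r)"

end

theory Submission
  imports Defs
begin

text \<open>
  Both metric formulas evaluate to the same matrix, the adjugate of the Jacobian \<open>J\<close>. Its
  entries are the \<open>2 \<times> 2\<close> minors \<open>u\<^sub>a v\<^sub>b - u\<^sub>b v\<^sub>a\<close> of pairs \<open>u, v\<close> of physical coordinates: the curl
  form reduces to such a minor by the product rule and the symmetry of second derivatives, and the
  terms absent from the non-conservative form vanish because \<open>t\<close> depends on \<open>\<tau>\<close> alone.

  The geometric conservation law is then a polynomial identity that survives discretization. A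
  minor has degree at most \<open>2n\<close> in \<open>\<tau>\<close> and \<open>2l\<close> in \<open>\<xi>, \<eta>\<close>, while the grid has \<open>m + 3n > 2n\<close> and
  \<open>k + 2l > 2l\<close> Gauss points in these directions, so interpolation at the solution points
  reproduces the metrics exactly (\<open>nodal_interp_exact\<close>). Condition (a) thereby becomes the
  statement that the columns of the adjugate are divergence free (\<open>piola_identity\<close>).

  In a freestream the transformed fluxes are combinations of metrics with constant coefficients.
  They are reproduced exactly as well and have divergence zero. Row \<open>b\<close> of the adjugate is
  \<open>det J\<close> times the gradient of the reference coordinate \<open>b\<close>, and the outward normal on the face
  \<open>b = \<plusminus>1\<close> is \<open>\<plusminus>1\<close> times the normalized gradient (\<open>outward_normal_eq\<close>). The scaling in the
  numerical flux undoes this normalization and this sign, so at every flux point it equals the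
  transformed flux; as interpolation on the face is exact too, the jumps at the faces, and with
  them the correction fluxes, vanish identically. This gives (b).

  For the equivalence of the two forms, the product rule is applied to the transformed fluxes. The
  terms in which a metric is differentiated cancel by the Piola identity, and the others are
  \<open>det J\<close> times the chain rule expression, since the adjugate equals \<open>det J\<close> times \<open>J\<^sup>-\<^sup>1\<close>.
  Solution and flux points lie in the closed reference cube, where \<open>det J \<noteq> 0\<close>.
\<close>

section \<open>Roots of Legendre polynomials\<close>

text \<open>
  Rolle's theorem between consecutive roots, for all gaps of a finite set of roots at once.
\<close>

lemma rolle_roots:
  fixes p :: "real poly"
  assumes "finite S" and "S \<noteq> {}" and "\<And>x. x \<in> S \<Longrightarrow> poly p x = 0"
  shows "\<exists>T. finite T \<and> Suc (card T) = card S \<and> T \<subseteq> {Min S<..<Max S}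
           \<and> (\<forall>x\<in>T. poly (pderiv p) x = 0)"
  using assms
proof (induction S rule: finite_linorder_max_induct)
  case empty
  then show ?case by simp
next
  case (insert b A)
  show ?case
  proof (cases "A = {}")
    case True
    then show ?thesis by (intro exI[of _ "{}"]) simp
  next
    case False
    from insert.IH[OF False] insert.prems obtain T where
      T: "finite T" "Suc (card T) = card A" "T \<subseteq> {Min A<..<Max A}"
         "\<And>x. x \<in> T \<Longrightarrow> poly (pderiv p) x = 0"
      by auto
    have MA: "Max A \<in> A" using False insert.hyps by simp
    then have lt: "Max A < b" using insert.hyps by blast
    obtain z where z: "Max A < z" "z < b"
        "poly p b - poly p (Max A) = (b - Max A) * poly (pderiv p) z"
      using poly_MVT[OF lt, of p] by blast
    then have pz: "poly (pderiv p) z = 0"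
      using insert.prems(2) MA lt by auto
    have le: "Min A \<le> Max A" using False insert.hyps by simp
    have mm: "Min (insert b A) = Min A" "Max (insert b A) = b"
      using False insert.hyps(1) lt le by simp_all
    have "z \<notin> T" using T(3) z(1) by fastforce
    then show ?thesis
      using T z pz insert.hyps mm le
      apply (intro exI[of _ "insert z T"])
      by (auto simp: card_insert_if)
  qed
qed

lemma linear_power_dvd_pderiv:
  fixes p :: "real poly"
  assumes "[:-a, 1:] ^ Suc i dvd p"
  shows "[:-a, 1:] ^ i dvd pderiv p"
proof -
  from assms obtain q where "p = [:-a, 1:] ^ Suc i * q" by (auto elim: dvdE)
  then have "pderiv p = [:-a, 1:] ^ Suc i * pderiv q
               + q * (smult (of_nat (Suc i)) ([:-a, 1:] ^ i) * pderiv [:-a, 1:])"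
    by (simp only: pderiv_mult pderiv_power_Suc)
  moreover have "[:-a, 1:] ^ i dvd [:-a, 1:] ^ Suc i" by (rule le_imp_power_dvd) simp
  ultimately show ?thesis
    by (simp only:) (intro dvd_add dvd_mult2 dvd_mult dvd_smult dvd_refl)
qed

lemma linear_power_dvd_higher_pderiv:
  fixes p :: "real poly"
  assumes "[:-a, 1:] ^ i dvd p" and "j \<le> i"
  shows "[:-a, 1:] ^ (i - j) dvd (pderiv ^^ j) p"
  using assms(2)
proof (induction j)
  case 0
  then show ?case using assms(1) by simp
next
  case (Suc j)
  then have "[:-a, 1:] ^ Suc (i - Suc j) dvd (pderiv ^^ j) p"
    by (simp add: Suc_diff_Suc)
  from linear_power_dvd_pderiv[OF this] show ?case by simp
qed

text \<open>
  Rodrigues' formula makes the Legendre polynomial a higher derivative of \<open>(z\<^sup>2 - 1)\<^sup>N\<close>. Each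
  differentiation gains one root in the open interval: for \<open>j < N\<close> the \<open>j\<close>-th derivative still
  vanishes at both end points, so its \<open>j\<close> interior roots together with these two have \<open>j + 1\<close>
  gaps.
\<close>

lemma higher_pderiv_roots:
  assumes "j \<le> N"
  shows "\<exists>T. finite T \<and> card T = j \<and> T \<subseteq> {-1<..<1}
           \<and> (\<forall>x\<in>T. poly ((pderiv ^^ j) ([:-1, 0, 1:] ^ N)) x = (0::real))"
  using assms
proof (induction j)
  case 0
  then show ?case by (intro exI[of _ "{}"]) simp
next
  case (Suc j)
  let ?p = "[:-1, 0, 1:] ^ N :: real poly"
  obtain T where T: "finite T" "card T = j" "T \<subseteq> {-1<..<1}"
      "\<And>x. x \<in> T \<Longrightarrow> poly ((pderiv ^^ j) ?p) x = 0"
    using Suc by auto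
  have fac: "?p = [:-1, 1:] ^ N * [:-(-1), 1:] ^ N"
    by (simp flip: power_mult_distrib)
  have end_root: "poly ((pderiv ^^ j) ?p) a = 0" if "a = 1 \<or> a = -1" for a
  proof -
    have "[:-a, 1:] ^ (N - j) dvd (pderiv ^^ j) ?p"
      using that Suc.prems unfolding fac
      by (intro linear_power_dvd_higher_pderiv) auto
    moreover have "[:-a, 1:] dvd [:-a, 1:] ^ (N - j)"
      using Suc.prems by (intro dvd_power) auto
    ultimately show ?thesis
      by (meson dvd_trans poly_eq_0_iff_dvd)
  qed
  let ?S = "insert (-1) (insert 1 T)"
  have cS: "card ?S = Suc (Suc j)"
    using T by (subst card_insert_disjoint; force)+
  have "Min ?S = -1" "Max ?S = 1"
    using T by (intro Min_eqI Max_eqI; force)+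
  with rolle_roots[of ?S "(pderiv ^^ j) ?p"] show ?case
    using T end_root cS by auto
qed

lemma legendre_poly_nonzero: "legendre_poly N \<noteq> 0"
proof
  assume "legendre_poly N = 0"
  then have 0: "(pderiv ^^ N) ([:-1, 0, 1:] ^ N :: real poly) = 0"
    by (simp add: legendre_poly_def)
  show False
  proof (cases N)
    case 0
    with \<open>legendre_poly N = 0\<close> show False by (simp add: legendre_poly_def)
  next
    case (Suc i)
    with 0 have "degree ((pderiv ^^ i) ([:-1, 0, 1:] ^ N :: real poly)) = 0"
      by (simp add: pderiv_eq_0_iff)
    then show False
      using Suc by (simp add: degree_higher_pderiv degree_power_eq del: power_Suc)
  qed
qed

text \<open>
  The \<open>N\<close> interior roots found by Rolle's theorem are all the roots, because the degree is at
  most \<open>N\<close>. The count gives the exactness of interpolation; the location gives the nonsingularity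
  of the Jacobian at solution and flux points.
\<close>

lemma gauss_points_card: "finite (gauss_points N)" "card (gauss_points N) = N"
  and gauss_points_interior: "gauss_points N \<subseteq> {-1<..<1}"
proof -
  obtain T where T: "finite T" "card T = N" "T \<subseteq> {-1<..<1}" "T \<subseteq> gauss_points N"
    using higher_pderiv_roots[of N N] unfolding gauss_points_def legendre_poly_def by auto
  have fin: "finite (gauss_points N)"
    unfolding gauss_points_def by (rule poly_roots_finite[OF legendre_poly_nonzero])
  have "card (gauss_points N) \<le> degree (legendre_poly N)"
    unfolding gauss_points_def by (rule card_poly_roots_bound[OF legendre_poly_nonzero])
  also have "\<dots> \<le> N"
    unfolding legendre_poly_def
    by (simp add: degree_higher_pderiv degree_power_eq)
  finally have "T = gauss_points N" using T fin by (intro card_seteq) auto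
  with T show "finite (gauss_points N)" "card (gauss_points N) = N"
    "gauss_points N \<subseteq> {-1<..<1}" by auto
qed

section \<open>Lagrange interpolation of powers\<close>

definition lagrange_poly :: "real set \<Rightarrow> real \<Rightarrow> real poly" where
  "lagrange_poly S p = (\<Prod>q\<in>S - {p}. smult (1 / (p - q)) [:-q, 1:])"

lemma poly_lagrange_poly: "poly (lagrange_poly S p) z = lagrange_basis S p z"
  by (simp add: lagrange_poly_def lagrange_basis_def poly_prod diff_divide_distrib algebra_simps)

text \<open>
  Both sides are polynomials in \<open>z\<close> of degree less than the number of nodes, and they agree at
  the nodes.
\<close>

lemma lagrange_reproduces_powers:
  assumes "finite S" and "i < card S"
  shows "(\<Sum>p\<in>S. lagrange_basis S p z * p ^ i) = z ^ i"
proof -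
  \<comment> \<open>\<open>L\<close> is the interpolant of the \<open>i\<close>-th power, as a polynomial.\<close>
  define L where "L = (\<Sum>p\<in>S. smult (p ^ i) (lagrange_poly S p))"
  have "degree (lagrange_poly S p) \<le> card S - 1" if "p \<in> S" for p
  proof -
    have "degree (lagrange_poly S p) \<le> (\<Sum>q\<in>S - {p}. 1)"
      unfolding lagrange_poly_def
      by (rule order_trans[OF degree_prod_sum_le sum_mono]) (use assms in auto)
    then show ?thesis using assms that by simp
  qed
  then have "degree L \<le> card S - 1"
    unfolding L_def using assms by (intro degree_sum_le) (auto intro: order_trans[OF degree_smult_le])
  moreover have "poly L x = poly (monom 1 i) x" if "x \<in> S" for x
  proof -
    have "lagrange_basis S p x = (if p = x then 1 else 0)" if "p \<in> S" for p
      using \<open>x \<in> S\<close> assms that unfolding lagrange_basis_def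
      by (auto intro!: prod.neutral prod_zero)
    then have "poly L x = (\<Sum>p\<in>S. p ^ i * (if p = x then 1 else 0))"
      unfolding L_def by (simp add: poly_sum poly_lagrange_poly)
    also have "\<dots> = x ^ i" using \<open>x \<in> S\<close> assms by (simp add: if_distrib sum.delta cong: if_cong)
    finally show ?thesis by (simp add: poly_monom)
  qed
  ultimately have "L = monom 1 i"
    using assms by (intro poly_eqI_degree[of S]) (auto simp: degree_monom_eq)
  then have "poly L z = z ^ i" by (simp add: poly_monom)
  then show ?thesis by (simp add: L_def poly_sum poly_lagrange_poly mult.commute)
qed

section \<open>Closure properties of tensor-product polynomials\<close>

lemma prod_UNIV_3: "prod f (UNIV :: 3 set) = f 1 * f 2 * f 3"
  for f :: "3 \<Rightarrow> 'a::comm_semiring_1"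
  unfolding UNIV_3 by (simp add: mult.assoc)

definition coord_monomial :: "(3 \<Rightarrow> nat) \<Rightarrow> real^3 \<Rightarrow> real" where
  "coord_monomial e r = (\<Prod>c\<in>UNIV. (r $ c) ^ e c)"

lemma coord_monomial_expand: "coord_monomial e r = r $ 1 ^ e 1 * r $ 2 ^ e 2 * r $ 3 ^ e 3"
  by (simp add: coord_monomial_def prod_UNIV_3)

lemma tensor_poly_coord_monomial:
  assumes "e 1 \<le> a" "e 2 \<le> b" "e 3 \<le> c"
  shows "tensor_poly a b c (\<lambda>r. coord_monomial e r *\<^sub>R (v :: 'a::real_normed_vector))"
  unfolding tensor_poly_def
proof (intro exI allI)
  fix r :: "real^3"
  let ?C = "\<lambda>i j k. if i = e 1 \<and> j = e 2 \<and> k = e 3 then v else 0"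
  have single: "(\<Sum>i\<le>n. h i) = h x" if "x \<le> n" "\<And>i. i \<noteq> x \<Longrightarrow> h i = 0"
    for n x :: nat and h :: "nat \<Rightarrow> 'a"
    using that by (subst sum.remove[of _ x]) (auto intro: sum.neutral)
  have "(\<Sum>i\<le>a. \<Sum>j\<le>b. \<Sum>k\<le>c. (r $ 1 ^ i * r $ 2 ^ j * r $ 3 ^ k) *\<^sub>R ?C i j k) =
      (\<Sum>j\<le>b. \<Sum>k\<le>c. (r $ 1 ^ e 1 * r $ 2 ^ j * r $ 3 ^ k) *\<^sub>R ?C (e 1) j k)"
    by (rule single) (simp_all add: assms)
  also have "\<dots> = (\<Sum>k\<le>c. (r $ 1 ^ e 1 * r $ 2 ^ e 2 * r $ 3 ^ k) *\<^sub>R ?C (e 1) (e 2) k)"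
    by (rule single) (simp_all add: assms)
  also have "\<dots> = (r $ 1 ^ e 1 * r $ 2 ^ e 2 * r $ 3 ^ e 3) *\<^sub>R ?C (e 1) (e 2) (e 3)"
    by (rule single) (simp_all add: assms)
  finally show "coord_monomial e r *\<^sub>R v =
      (\<Sum>i\<le>a. \<Sum>j\<le>b. \<Sum>k\<le>c. (r $ 1 ^ i * r $ 2 ^ j * r $ 3 ^ k) *\<^sub>R ?C i j k)"
    by (simp add: coord_monomial_expand)
qed

lemma tensor_poly_add:
  assumes "tensor_poly a b c f" "tensor_poly a b c g"
  shows "tensor_poly a b c (\<lambda>r. f r + g r)"
proof -
  obtain C D where "\<forall>r. f r = (\<Sum>i\<le>a. \<Sum>j\<le>b. \<Sum>k\<le>c. (r $ 1 ^ i * r $ 2 ^ j * r $ 3 ^ k) *\<^sub>R C i j k)"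
    "\<forall>r. g r = (\<Sum>i\<le>a. \<Sum>j\<le>b. \<Sum>k\<le>c. (r $ 1 ^ i * r $ 2 ^ j * r $ 3 ^ k) *\<^sub>R D i j k)"
    using assms unfolding tensor_poly_def by auto
  then show ?thesis
    unfolding tensor_poly_def
    by (intro exI[of _ "\<lambda>i j k. C i j k + D i j k"]) (simp add: sum.distrib scaleR_add_right)
qed

text \<open>
  Properties that are additive in the polynomial reduce to monomials by this rule. The zero
  polynomial needs no case of its own, being a monomial with coefficient 0.
\<close>

lemma tensor_poly_induct [consumes 1, case_names monomial add]:
  fixes f :: "real^3 \<Rightarrow> 'a::real_normed_vector"
  assumes "tensor_poly a b c f"
    and mono: "\<And>e v. e 1 \<le> a \<Longrightarrow> e 2 \<le> b \<Longrightarrow> e 3 \<le> c \<Longrightarrow> P (\<lambda>r. coord_monomial e r *\<^sub>R v)"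
    and add: "\<And>f g. P f \<Longrightarrow> P g \<Longrightarrow> P (\<lambda>r. f r + g r)"
  shows "P f"
proof -
  have sum: "P (\<lambda>r. \<Sum>i\<in>I. h i r)" if "finite I" "\<And>i. i \<in> I \<Longrightarrow> P (h i)" for I :: "nat set" and h
    using that
  proof (induction I rule: finite_induct)
    case empty
    show ?case using mono[of "\<lambda>_. 0" 0] by simp
  next
    case (insert x I)
    then show ?case by (simp add: add)
  qed
  obtain C where "\<forall>r. f r = (\<Sum>i\<le>a. \<Sum>j\<le>b. \<Sum>k\<le>c. (r $ 1 ^ i * r $ 2 ^ j * r $ 3 ^ k) *\<^sub>R C i j k)"
    using assms(1) unfolding tensor_poly_def by auto
  then have f: "f = (\<lambda>r. \<Sum>i\<le>a. \<Sum>j\<le>b. \<Sum>k\<le>c.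
      coord_monomial (\<lambda>d. if d = 1 then i else if d = 2 then j else k) r *\<^sub>R C i j k)"
    by (intro ext) (simp only: coord_monomial_expand, simp)
  show ?thesis unfolding f by (intro sum mono) auto
qed

lemma tensor_poly_mono:
  assumes "tensor_poly a b c f" "a \<le> a'" "b \<le> b'" "c \<le> c'"
  shows "tensor_poly a' b' c' f"
  using assms(1)
  by (induction rule: tensor_poly_induct)
    (use assms in \<open>auto intro: tensor_poly_coord_monomial tensor_poly_add\<close>)

lemma tensor_poly_scaleR:
  fixes g :: "real^3 \<Rightarrow> 'a::real_normed_vector"
  assumes "tensor_poly a b c f" "tensor_poly a' b' c' g"
  shows "tensor_poly (a + a') (b + b') (c + c') (\<lambda>r. f r *\<^sub>R g r)"
  using assms(1)
proof (induction rule: tensor_poly_induct)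
  case (monomial e v)
  from assms(2) show ?case
  proof (induction rule: tensor_poly_induct)
    case (monomial e' w)
    have "(\<lambda>r. (coord_monomial e r *\<^sub>R v) *\<^sub>R coord_monomial e' r *\<^sub>R w) =
          (\<lambda>r. coord_monomial (\<lambda>c. e c + e' c) r *\<^sub>R v *\<^sub>R w)"
      by (simp add: coord_monomial_def power_add prod.distrib mult_ac)
    then show ?case
      using monomial \<open>e 1 \<le> a\<close> \<open>e 2 \<le> b\<close> \<open>e 3 \<le> c\<close>
      by (simp only: tensor_poly_coord_monomial add_mono)
  next
    case (add f g)
    then show ?case by (simp add: scaleR_add_right tensor_poly_add)
  qed
next
  case (add f g)
  then show ?case by (simp add: scaleR_add_left tensor_poly_add)
qed

lemma tensor_poly_const: "tensor_poly a b c (\<lambda>_. v)"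
  using tensor_poly_coord_monomial[of "\<lambda>_. 0" a b c v] by (simp add: coord_monomial_def)

lemma tensor_poly_diff:
  fixes f g :: "real^3 \<Rightarrow> 'a::real_normed_vector"
  assumes "tensor_poly a b c f" "tensor_poly a b c g"
  shows "tensor_poly a b c (\<lambda>r. f r - g r)"
  using tensor_poly_add[OF assms(1) tensor_poly_scaleR[OF tensor_poly_const[of 0 0 0 "-1"] assms(2), simplified]]
  by simp

lemma tensor_poly_mult:
  assumes "tensor_poly a b c f" "tensor_poly a' b' c' g"
  shows "tensor_poly (a + a') (b + b') (c + c') (\<lambda>r. f r * g r :: real)"
  using tensor_poly_scaleR[OF assms] by simp

section \<open>Partial derivatives of tensor-product polynomials\<close>

definition coord_differentiable :: "3 \<Rightarrow> (real^3 \<Rightarrow> 'a::real_normed_vector) \<Rightarrow> real^3 \<Rightarrow> bool" where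
  "coord_differentiable b f r \<longleftrightarrow> (\<lambda>s. f (set_coord b s r)) differentiable (at (r $ b))"

lemma set_coord_same [simp]: "set_coord b (r $ b) r = r"
  by (simp add: set_coord_def vec_eq_iff)

lemma set_coord_nth: "set_coord b s r $ c = (if c = b then s else r $ c)"
  by (simp add: set_coord_def)

lemma has_partial_derivative:
  "coord_differentiable b f r \<Longrightarrow>
     ((\<lambda>s. f (set_coord b s r)) has_vector_derivative partial_deriv b f r) (at (r $ b))"
  by (simp add: coord_differentiable_def partial_deriv_def flip: vector_derivative_works)

lemma partial_derivI:
  assumes "((\<lambda>s. f (set_coord b s r)) has_vector_derivative D) (at (r $ b))"
  shows "coord_differentiable b f r" "partial_deriv b f r = D"
  using assms by (auto simp: coord_differentiable_def partial_deriv_def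
      intro: vector_derivative_at differentiableI_vector)

lemma partial_deriv_add:
  assumes "coord_differentiable b f r" "coord_differentiable b g r"
  shows "coord_differentiable b (\<lambda>r. f r + g r) r"
    "partial_deriv b (\<lambda>r. f r + g r) r = partial_deriv b f r + partial_deriv b g r"
  using partial_derivI[OF has_vector_derivative_add[OF assms[THEN has_partial_derivative]]] by auto

lemma partial_deriv_scaleR:
  assumes "coord_differentiable b f r" "coord_differentiable b g r"
  shows "coord_differentiable b (\<lambda>r. f r *\<^sub>R g r) r"
    "partial_deriv b (\<lambda>r. f r *\<^sub>R g r) r = f r *\<^sub>R partial_deriv b g r + partial_deriv b f r *\<^sub>R g r"
  using partial_derivI[OF has_vector_derivative_scaleR[OF
      assms(1)[THEN has_partial_derivative, folded has_real_derivative_iff_has_vector_derivative]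
      assms(2)[THEN has_partial_derivative]]] by auto

lemma partial_deriv_mult:
  fixes f g :: "real^3 \<Rightarrow> real"
  assumes "coord_differentiable b f r" "coord_differentiable b g r"
  shows "partial_deriv b (\<lambda>r. f r * g r) r = f r * partial_deriv b g r + partial_deriv b f r * g r"
  using partial_deriv_scaleR(2)[OF assms] by simp

lemma partial_deriv_diff:
  fixes f g :: "real^3 \<Rightarrow> 'a::real_normed_vector"
  assumes "coord_differentiable b f r" "coord_differentiable b g r"
  shows "partial_deriv b (\<lambda>r. f r - g r) r = partial_deriv b f r - partial_deriv b g r"
  using partial_derivI(2)[OF has_vector_derivative_diff[OF assms[THEN has_partial_derivative]]] .

lemma partial_deriv_const:
  "coord_differentiable b (\<lambda>_. v) r" "partial_deriv b (\<lambda>_. v) r = 0"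
  using partial_derivI[of "\<lambda>_. v" b r 0] by auto

lemma partial_deriv_sum:
  assumes "\<And>i. i \<in> I \<Longrightarrow> coord_differentiable b (f i) r"
  shows "coord_differentiable b (\<lambda>r. \<Sum>i\<in>I. f i r) r"
    "partial_deriv b (\<lambda>r. \<Sum>i\<in>I. f i r) r = (\<Sum>i\<in>I. partial_deriv b (f i) r)"
proof -
  have "((\<lambda>s. \<Sum>i\<in>I. f i (set_coord b s r)) has_vector_derivative
          (\<Sum>i\<in>I. partial_deriv b (f i) r)) (at (r $ b))"
    by (intro has_vector_derivative_sum has_partial_derivative assms)
  from partial_derivI[OF this]
  show "coord_differentiable b (\<lambda>r. \<Sum>i\<in>I. f i r) r"
    "partial_deriv b (\<lambda>r. \<Sum>i\<in>I. f i r) r = (\<Sum>i\<in>I. partial_deriv b (f i) r)" .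
qed

text \<open>
  For \<open>e b = 0\<close> the truncated exponent on the right is harmless, since the coefficient
  \<open>e b\<close> vanishes.
\<close>

lemma partial_deriv_coord_monomial:
  "((\<lambda>s. coord_monomial e (set_coord b s r) *\<^sub>R v) has_vector_derivative
     coord_monomial (e(b := e b - 1)) r *\<^sub>R real (e b) *\<^sub>R v) (at (r $ b))"
proof -
  let ?R = "\<Prod>c\<in>UNIV - {b}. (r $ c) ^ e c"
  have rest: "(\<Prod>c\<in>UNIV - {b}. (set_coord b s r $ c) ^ e' c) = ?R"
    if "\<And>c. c \<noteq> b \<Longrightarrow> e' c = e c" for s e'
    using that by (intro prod.cong) (auto simp: set_coord_nth)
  have 1: "coord_monomial e (set_coord b s r) = s ^ e b * ?R" for s
    unfolding coord_monomial_def
    by (subst prod.remove[of UNIV b]) (auto simp: rest set_coord_nth)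
  have "coord_monomial (e(b := e b - 1)) (set_coord b (r $ b) r) = (r $ b) ^ (e b - 1) * ?R"
    unfolding coord_monomial_def
    by (subst prod.remove[of UNIV b]) (auto simp: rest set_coord_nth)
  then have 2: "coord_monomial (e(b := e b - 1)) r = (r $ b) ^ (e b - 1) * ?R" by simp
  have "((\<lambda>s. s ^ e b * ?R) has_real_derivative (real (e b) * (r $ b) ^ (e b - 1)) * ?R) (at (r $ b))"
    by (auto intro!: derivative_eq_intros)
  then have "((\<lambda>s. (s ^ e b * ?R) *\<^sub>R v) has_vector_derivative
      ((real (e b) * (r $ b) ^ (e b - 1)) * ?R) *\<^sub>R v) (at (r $ b))"
    by (intro derivative_eq_intros | simp)+
  then show ?thesis unfolding 1 2 by (simp add: mult_ac)
qed

text \<open>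
  The bound on the degree in direction \<open>d\<close> is kept rather than lowered by one: the crude degrees
  \<open>2n\<close> and \<open>2l\<close> of the metrics are already below the numbers of solution points.
\<close>

lemma
  fixes f :: "real^3 \<Rightarrow> 'a::real_normed_vector"
  assumes "tensor_poly a b c f"
  shows tensor_poly_coord_differentiable: "coord_differentiable d f r"
    and tensor_poly_partial_deriv: "tensor_poly a b c (partial_deriv d f)"
proof -
  have "(\<forall>r. coord_differentiable d f r) \<and> tensor_poly a b c (partial_deriv d f)"
    using assms
  proof (induction rule: tensor_poly_induct)
    case (monomial e v)
    have "partial_deriv d (\<lambda>r. coord_monomial e r *\<^sub>R v) =
        (\<lambda>r. coord_monomial (e(d := e d - 1)) r *\<^sub>R real (e d) *\<^sub>R v)"
      by (intro ext partial_derivI(2) partial_deriv_coord_monomial)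
    then show ?case
      using monomial partial_derivI(1)[OF partial_deriv_coord_monomial[of e d _ v]]
      by (auto intro!: tensor_poly_coord_monomial simp del: scaleR_scaleR)
  next
    case (add f g)
    then show ?case
      by (simp add: partial_deriv_add tensor_poly_add)
  qed
  then show "coord_differentiable d f r" "tensor_poly a b c (partial_deriv d f)" by auto
qed

lemma tensor_poly_partial_deriv_commute:
  fixes f :: "real^3 \<Rightarrow> 'a::real_normed_vector"
  assumes "tensor_poly a b c f"
  shows "partial_deriv d (partial_deriv d' f) r = partial_deriv d' (partial_deriv d f) r"
proof (cases "d = d'")
  case False
  have "tensor_poly a b c f \<and>
      (\<forall>r. partial_deriv d (partial_deriv d' f) r = partial_deriv d' (partial_deriv d f) r)"
    using assms
  proof (induction rule: tensor_poly_induct)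
    case (monomial e v)
    have D: "partial_deriv d (\<lambda>r. coord_monomial e r *\<^sub>R v) =
        (\<lambda>r. coord_monomial (e(d := e d - 1)) r *\<^sub>R real (e d) *\<^sub>R v)" for d e and v :: 'a
      by (intro ext partial_derivI(2) partial_deriv_coord_monomial)
    show ?case
      using monomial False 
      by (simp add: D tensor_poly_coord_monomial fun_upd_twist del: scaleR_scaleR)
        (simp add: mult_ac)
  next
    case (add f g)
    have D: "partial_deriv d (\<lambda>r. f r + g r) = (\<lambda>r. partial_deriv d f r + partial_deriv d g r)"
      if "tensor_poly a b c f" "tensor_poly a b c g" for d and f g :: "real^3 \<Rightarrow> 'a"
      using that by (intro ext partial_deriv_add(2)) (blast intro: tensor_poly_coord_differentiable)+
    then show ?case
      using add by (simp add: D tensor_poly_partial_deriv tensor_poly_add)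
  qed
  then show ?thesis by simp
qed simp

section \<open>Exactness of interpolation on tensor grids\<close>

lemma sum_prod_grid:
  fixes h :: "3 \<Rightarrow> real \<Rightarrow> real"
  assumes "\<And>c. finite (S c)"
  shows "(\<Sum>p\<in>{p :: real^3. \<forall>c. p $ c \<in> S c}. \<Prod>c\<in>UNIV. h c (p $ c))
       = (\<Prod>c\<in>UNIV. \<Sum>s\<in>S c. h c s)"
proof -
  have "bij_betw vec_nth {p :: real^3. \<forall>c. p $ c \<in> S c} (PiE UNIV S)"
    by (rule bij_betwI[where g = vec_lambda]) auto
  then show ?thesis
    using assms by (simp add: prod_sum_PiE sum.reindex_bij_betw[symmetric])
qed

text \<open>
  A tensor grid with product weights acts on a monomial direction by direction. Letting the weights
  and nodes depend on the direction covers interpolation in the volume as well as on a face, where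
  the normal direction has a single node of weight 1.
\<close>

lemma tensor_poly_grid_sum:
  fixes f :: "real^3 \<Rightarrow> 'a::real_normed_vector"
  assumes "tensor_poly (d 1) (d 2) (d 3) f"
    and fin: "\<And>c. finite (S c)"
    and pow: "\<And>c i. i \<le> d c \<Longrightarrow> (\<Sum>s\<in>S c. W c s * s ^ i) = (r $ c) ^ i"
  shows "(\<Sum>p\<in>{p :: real^3. \<forall>c. p $ c \<in> S c}. (\<Prod>c\<in>UNIV. W c (p $ c)) *\<^sub>R f p) = f r"
  using assms(1)
proof (induction rule: tensor_poly_induct)
  case (monomial e v)
  have le: "e c \<le> d c" for c
    using monomial exhaust_3[of c] by auto
  have "(\<Sum>p\<in>{p :: real^3. \<forall>c. p $ c \<in> S c}.
            (\<Prod>c\<in>UNIV. W c (p $ c)) *\<^sub>R coord_monomial e p *\<^sub>R v)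
      = (\<Sum>p\<in>{p :: real^3. \<forall>c. p $ c \<in> S c}. \<Prod>c\<in>UNIV. W c (p $ c) * (p $ c) ^ e c) *\<^sub>R v"
    by (simp add: coord_monomial_def prod.distrib scaleR_sum_left)
  also have "\<dots> = coord_monomial e r *\<^sub>R v"
    by (subst sum_prod_grid[OF fin, of "\<lambda>c s. W c s * s ^ e c"])
      (simp add: pow[OF le] coord_monomial_def)
  finally show ?case .
next
  case (add f g)
  then show ?case by (simp add: scaleR_add_right sum.distrib)
qed

lemma nodal_interp_exact:
  fixes f :: "real^3 \<Rightarrow> 'a::real_normed_vector"
  assumes "tensor_poly (d 1) (d 2) (d 3) f" and "\<And>c. d c < N c"
  shows "nodal_interp N f r = f r"
  unfolding nodal_interp_def sol_points_def nodal_basis_def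
  by (rule tensor_poly_grid_sum[OF assms(1)])
    (use assms(2) in \<open>auto intro!: lagrange_reproduces_powers gauss_points_card(1)
       simp: gauss_points_card(2) intro: order_le_less_trans\<close>)

lemma face_interp_exact:
  fixes f :: "real^3 \<Rightarrow> 'a::real_normed_vector"
  assumes "tensor_poly (d 1) (d 2) (d 3) f" and "\<And>c. d c < N c"
  shows "face_interp N b \<sigma> f r = f (set_coord b \<sigma> r)"
proof -
  \<comment> \<open>The face grid as a tensor grid, degenerate in the normal direction.\<close>
  let ?S = "\<lambda>c. if c = b then {\<sigma>} else gauss_points (N c)"
  let ?W = "\<lambda>c s. if c = b then 1 else lagrange_basis (gauss_points (N c)) s (r $ c)"
  have "flux_points N b \<sigma> = {p. \<forall>c. p $ c \<in> ?S c}"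
    unfolding flux_points_def by auto
  moreover have "(\<Prod>c\<in>UNIV - {b}. lagrange_basis (gauss_points (N c)) (p $ c) (r $ c))
      = (\<Prod>c\<in>UNIV. ?W c (p $ c))" for p :: "real^3"
    by (subst (2) prod.remove[of _ b]) (auto intro: prod.cong)
  ultimately have "face_interp N b \<sigma> f r =
      (\<Sum>p\<in>{p. \<forall>c. p $ c \<in> ?S c}. (\<Prod>c\<in>UNIV. ?W c (p $ c)) *\<^sub>R f p)"
    by (simp add: face_interp_def)
  also have "\<dots> = f (set_coord b \<sigma> r)"
  proof (rule tensor_poly_grid_sum[OF assms(1)])
    show "finite (?S c)" for c by (simp add: gauss_points_card(1))
    show "(\<Sum>s\<in>?S c. ?W c s * s ^ i) = (set_coord b \<sigma> r $ c) ^ i" if "i \<le> d c" for c i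
      using lagrange_reproduces_powers[OF gauss_points_card(1), of i "N c" "r $ c"]
        assms(2)[of c] that
      by (simp add: set_coord_nth gauss_points_card(2))
  qed
  finally show ?thesis .
qed

lemma coord_differentiable_nodal_basis: "coord_differentiable b (nodal_basis N p) r"
proof -
  have 1: "(\<lambda>s. lagrange_basis S q s) differentiable (at x)" for S q x
    unfolding poly_lagrange_poly[symmetric] real_differentiable_def
    by (rule exI, rule poly_DERIV)
  have "(\<lambda>s. lagrange_basis (gauss_points (N c)) (p $ c) (set_coord b s r $ c))
          differentiable (at (r $ b))" for c
    using 1 by (cases "c = b") (simp_all add: set_coord_nth)
  then show ?thesis
    unfolding coord_differentiable_def nodal_basis_def prod_UNIV_3
    by (intro differentiable_mult)
qed

lemma flux_points_in_ref_cube: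
  assumes "\<sigma> = -1 \<or> \<sigma> = 1" and "p \<in> flux_points N b \<sigma>"
  shows "p \<in> ref_cube"
  unfolding ref_cube_def
proof (intro CollectI allI)
  fix c
  show "-1 \<le> p $ c \<and> p $ c \<le> 1"
    using assms gauss_points_interior[of "N c"]
    by (cases "c = b") (fastforce simp: flux_points_def)+
qed

lemma sol_points_in_ref_cube: "sol_points N \<subseteq> ref_cube"
  unfolding ref_cube_def
proof (intro subsetI CollectI allI)
  fix p c
  assume "p \<in> sol_points N"
  then have "p $ c \<in> {-1<..<1}"
    using gauss_points_interior[of "N c"] by (auto simp: sol_points_def)
  then show "-1 \<le> p $ c \<and> p $ c \<le> 1" by simp
qed

section \<open>The metrics as Jacobian minors\<close>

definition jacobian_minor :: "3 \<Rightarrow> 3 \<Rightarrow> (real^3 \<Rightarrow> real) \<Rightarrow> (real^3 \<Rightarrow> real) \<Rightarrow> real^3 \<Rightarrow> real" where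
  "jacobian_minor a b u v r =
     partial_deriv a u r * partial_deriv b v r - partial_deriv b u r * partial_deriv a v r"

lemma tensor_poly_jacobian_minor:
  assumes "tensor_poly a b c u" "tensor_poly a b c v"
  shows "tensor_poly (2 * a) (2 * b) (2 * c) (jacobian_minor d d' u v)"
proof -
  have "tensor_poly (a + a) (b + b) (c + c) (jacobian_minor d d' u v)"
    unfolding jacobian_minor_def
    by (intro tensor_poly_diff tensor_poly_mult tensor_poly_partial_deriv assms)
  then show ?thesis by (simp add: mult_2)
qed

text \<open>
  In the curl form the products with second derivatives cancel, and each product of first
  derivatives occurs twice, which the factor \<open>1/2\<close> compensates.
\<close>

lemma curl_form_eq_jacobian_minor:
  assumes "tensor_poly a b c u" "tensor_poly a b c v"
  shows "curl_form d d' u v r = jacobian_minor d d' u v r"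
proof -
  note diff = tensor_poly_coord_differentiable[OF assms(1)]
    tensor_poly_coord_differentiable[OF assms(2)]
    tensor_poly_coord_differentiable[OF tensor_poly_partial_deriv[OF assms(1)]]
    tensor_poly_coord_differentiable[OF tensor_poly_partial_deriv[OF assms(2)]]
  show ?thesis
    unfolding curl_form_def jacobian_minor_def
    by (simp add: partial_deriv_mult diff
        tensor_poly_partial_deriv_commute[OF assms(1), of d d']
        tensor_poly_partial_deriv_commute[OF assms(2), of d d'])
qed

text \<open>
  The vector of the three minors is the cross product of the gradients of \<open>u\<close> and \<open>v\<close>, that is,
  the curl of \<open>u \<nabla>v\<close>; hence its divergence is zero.
\<close>

lemma piola_identity:
  assumes "tensor_poly a b c u" "tensor_poly a b c v"
  shows "d_tau (jacobian_minor 2 3 u v) r + d_xi (jacobian_minor 3 1 u v) r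
       + d_eta (jacobian_minor 1 2 u v) r = 0"
proof -
  note D = tensor_poly_partial_deriv[OF assms(1)] tensor_poly_partial_deriv[OF assms(2)]
  note diff = D[THEN tensor_poly_coord_differentiable]
    D(1)[THEN tensor_poly_mult[OF _ D(2)], THEN tensor_poly_coord_differentiable]
  have minor: "partial_deriv e (jacobian_minor d d' u v) r =
      partial_deriv d u r * partial_deriv e (partial_deriv d' v) r
      + partial_deriv e (partial_deriv d u) r * partial_deriv d' v r
      - (partial_deriv d' u r * partial_deriv e (partial_deriv d v) r
      + partial_deriv e (partial_deriv d' u) r * partial_deriv d v r)" for d d' e
    unfolding jacobian_minor_def
    by (simp add: partial_deriv_diff partial_deriv_mult diff)
  show ?thesis
    unfolding minor
    by (simp add: algebra_simps
        tensor_poly_partial_deriv_commute[OF assms(1), of 2 1]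
        tensor_poly_partial_deriv_commute[OF assms(1), of 3 1]
        tensor_poly_partial_deriv_commute[OF assms(1), of 3 2]
        tensor_poly_partial_deriv_commute[OF assms(2), of 2 1]
        tensor_poly_partial_deriv_commute[OF assms(2), of 3 1]
        tensor_poly_partial_deriv_commute[OF assms(2), of 3 2])
qed

text \<open>
  The common value of the two metric formulas; row \<open>b\<close>, column \<open>a\<close> holds the cofactor of the
  entry of the Jacobian in row \<open>a\<close>, column \<open>b\<close>.
\<close>

definition adjugate_metrics :: "(real^3 \<Rightarrow> real^3) \<Rightarrow> real^3 \<Rightarrow> real^3^3" where
  "adjugate_metrics X r =
     (let t = (\<lambda>p. X p $ 1); x = (\<lambda>p. X p $ 2); y = (\<lambda>p. X p $ 3) in
      vector
       [vector [jacobian_minor 2 3 x y r, jacobian_minor 2 3 y t r, jacobian_minor 2 3 t x r],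
        vector [jacobian_minor 3 1 x y r, jacobian_minor 3 1 y t r, jacobian_minor 3 1 t x r],
        vector [jacobian_minor 1 2 x y r, jacobian_minor 1 2 y t r, jacobian_minor 1 2 t x r]])"

lemma adjugate_metrics_mult_jacobian:
  "adjugate_metrics X r ** jacobian X r = det (jacobian X r) *\<^sub>R mat 1"
  by (simp add: vec_eq_iff matrix_matrix_mult_def forall_3 sum_3 det_3 jacobian_def mat_def
      adjugate_metrics_def Let_def jacobian_minor_def vector_3)
    (simp add: algebra_simps)

lemma
  assumes "det (jacobian X r) \<noteq> 0"
  shows jacobian_inv_right: "jacobian X r ** inv_jacobian X r = mat 1"
    and jacobian_inv_left: "inv_jacobian X r ** jacobian X r = mat 1"
proof -
  have "\<exists>K. jacobian X r ** K = mat 1 \<and> K ** jacobian X r = mat 1"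
    using assms invertible_det_nz[of "jacobian X r"] by (simp add: invertible_def)
  from someI_ex[OF this]
  show "jacobian X r ** inv_jacobian X r = mat 1" "inv_jacobian X r ** jacobian X r = mat 1"
    by (simp_all add: inv_jacobian_def matrix_inv_def)
qed

lemma adjugate_metrics_eq_det_inv_jacobian:
  assumes "det (jacobian X r) \<noteq> 0"
  shows "adjugate_metrics X r = det (jacobian X r) *\<^sub>R inv_jacobian X r"
proof -
  have "adjugate_metrics X r = adjugate_metrics X r ** jacobian X r ** inv_jacobian X r"
    by (simp add: jacobian_inv_right[OF assms] flip: matrix_mul_assoc)
  also have "\<dots> = det (jacobian X r) *\<^sub>R inv_jacobian X r"
    by (simp add: adjugate_metrics_mult_jacobian flip: scalar_matrix_assoc)
  finally show ?thesis .
qed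

lemma partial_deriv_tau_only:
  assumes "tensor_poly n 0 0 f" and "b \<noteq> 1"
  shows "partial_deriv b f r = 0"
proof -
  have "f (set_coord b s r) = f r" for s
    using assms by (auto simp: tensor_poly_def set_coord_nth)
  then show ?thesis by (simp add: partial_deriv_def)
qed

lemma
  assumes "slab_element l n X"
  shows slab_coord_tensor_poly: "tensor_poly n l l (\<lambda>p. X p $ a)"
    and slab_time_deriv: "b \<noteq> 1 \<Longrightarrow> partial_deriv b (\<lambda>p. X p $ 1) r = 0"
proof -
  show "tensor_poly n l l (\<lambda>p. X p $ a)"
    using assms exhaust_3[of a] by (auto simp: slab_element_def intro: tensor_poly_mono)
  show "partial_deriv b (\<lambda>p. X p $ 1) r = 0" if "b \<noteq> 1"
    using assms that by (intro partial_deriv_tau_only) (auto simp: slab_element_def)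
qed

lemma slab_metrics_eq_adjugate_metrics:
  assumes "slab_element l n X"
  shows "nonconservative_metrics X = adjugate_metrics X"
    and "conservative_metrics X = adjugate_metrics X"
proof -
  have "d_xi (\<lambda>p. X p $ 1) r = 0" "d_eta (\<lambda>p. X p $ 1) r = 0" for r
    by (rule slab_time_deriv[OF assms]; simp)+
  then show "nonconservative_metrics X = adjugate_metrics X"
    by (simp add: fun_eq_iff nonconservative_metrics_def adjugate_metrics_def Let_def
        jacobian_minor_def vec_eq_iff forall_3 vector_3)
  show "conservative_metrics X = adjugate_metrics X"
    by (simp add: fun_eq_iff conservative_metrics_def adjugate_metrics_def Let_def
        curl_form_eq_jacobian_minor[OF slab_coord_tensor_poly[OF assms]
          slab_coord_tensor_poly[OF assms]])
qed

text \<open>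
  The rows of the inverse Jacobian form the basis dual to the columns of the Jacobian. A vector
  orthogonal to all columns but column \<open>b\<close> is therefore a multiple of row \<open>b\<close>; unit length and the
  sign condition determine the factor.
\<close>

lemma outward_normal_eq:
  fixes X :: "real^3 \<Rightarrow> real^3" and b :: 3 and \<sigma> :: real
  assumes det: "det (jacobian X r) \<noteq> 0" and \<sigma>: "\<sigma> = -1 \<or> \<sigma> = 1"
  defines "g \<equiv> row b (inv_jacobian X r)"
  shows "outward_normal X b \<sigma> r = (\<sigma> / norm g) *\<^sub>R g" and "g \<noteq> 0"
proof -
  let ?J = "jacobian X r" and ?K = "inv_jacobian X r"
  note KJ = jacobian_inv_left[OF det] and JK = jacobian_inv_right[OF det]
  have dual: "g \<bullet> column c ?J = (if c = b then 1 else 0)" for c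
    using arg_cong[OF KJ, of "\<lambda>A. A $ b $ c"]
    by (auto simp: g_def mat_def matrix_matrix_mult_def inner_vec_def row_def column_def)
  then show "g \<noteq> 0" by (metis inner_zero_left zero_neq_one)
  then have g: "norm g > 0" by simp
  have multiple: "\<nu> = (\<nu> \<bullet> column b ?J) *\<^sub>R g" if "\<And>c. c \<noteq> b \<Longrightarrow> \<nu> \<bullet> column c ?J = 0" for \<nu>
  proof -
    \<comment> \<open>The coordinates of \<open>\<nu> v* J\<close> are the inner products with the columns; only the one at \<open>b\<close> survives.\<close>
    have "\<nu> v* ?J = (\<nu> \<bullet> column b ?J) *\<^sub>R axis b 1"
      using that by (auto simp: vec_eq_iff vector_matrix_mult_def inner_vec_def column_def
          axis_def mult.commute)
    then have "\<nu> v* ?J v* ?K = (\<nu> \<bullet> column b ?J) *\<^sub>R (axis b 1 v* ?K)"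
      by (simp add: scaleR_vector_matrix_assoc)
    moreover have "axis b 1 v* ?K = g"
      by (simp add: vec_eq_iff vector_matrix_mult_def axis_def g_def row_def if_distrib if_distribR
          cong: if_cong)
    ultimately show ?thesis by (simp add: vector_matrix_mul_assoc JK)
  qed
  show "outward_normal X b \<sigma> r = (\<sigma> / norm g) *\<^sub>R g"
    unfolding outward_normal_def
  proof (rule the_equality)
    show "norm ((\<sigma> / norm g) *\<^sub>R g) = 1 \<and>
      (\<forall>c. c \<noteq> b \<longrightarrow> ((\<sigma> / norm g) *\<^sub>R g) \<bullet> column c ?J = 0) \<and>
      ((\<sigma> / norm g) *\<^sub>R g) \<bullet> (\<sigma> *\<^sub>R column b ?J) > 0"
      using \<sigma> g by (auto simp: dual)
  next
    fix \<nu>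
    assume \<nu>: "norm \<nu> = 1 \<and> (\<forall>c. c \<noteq> b \<longrightarrow> \<nu> \<bullet> column c ?J = 0) \<and> \<nu> \<bullet> (\<sigma> *\<^sub>R column b ?J) > 0"
    define k where "k = \<nu> \<bullet> column b ?J"
    have k: "\<nu> = k *\<^sub>R g" unfolding k_def by (rule multiple) (use \<nu> in auto)
    have "\<bar>k\<bar> * norm g = 1" using \<nu> k by auto
    moreover have "\<sigma> * k > 0" using \<nu> by (simp add: k_def)
    ultimately have "k = \<sigma> / norm g"
      using \<sigma> g by (auto simp: field_simps abs_if split: if_splits)
    with k show "\<nu> = (\<sigma> / norm g) *\<^sub>R g" by simp
  qed
qed

lemma lax_friedrichs_consistent: "lax_friedrichs F G speed \<nu> q q = normal_flux F G \<nu> q"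
  by (simp add: lax_friedrichs_def flip: scaleR_2)

text \<open>
  The factor \<open>|\<nabla>\<zeta>|\<close> cancels the normalization of the normal, and the sign factor cancels its
  orientation, so that the normal flux is taken along \<open>det J\<close> times the unnormalized gradient,
  which is a row of the adjugate.
\<close>

lemma numerical_flux_freestream:
  fixes F G :: "real^'v \<Rightarrow> real^'v"
  assumes det: "det (jacobian X p) \<noteq> 0" and \<sigma>: "\<sigma> = -1 \<or> \<sigma> = 1"
  shows "numerical_flux X F G speed (\<lambda>_. q) (\<lambda>_ _ _. q) b \<sigma> p
       = normal_flux F G (adjugate_metrics X p $ b) q"
proof -
  let ?g = "row b (inv_jacobian X p)"
  note \<nu> = outward_normal_eq[OF assms, of b]
  have "sgn (outward_normal X b \<sigma> p \<bullet> ?g) = \<sigma>"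
    using \<sigma> \<nu>(2) by (auto simp: \<nu>(1) dot_square_norm sgn_mult)
  then have "numerical_flux X F G speed (\<lambda>_. q) (\<lambda>_ _ _. q) b \<sigma> p
      = (det (jacobian X p) * norm ?g * \<sigma>) *\<^sub>R normal_flux F G ((\<sigma> / norm ?g) *\<^sub>R ?g) q"
    by (simp add: numerical_flux_def Let_def lax_friedrichs_consistent \<nu>(1))
  also have "\<dots> = normal_flux F G (det (jacobian X p) *\<^sub>R ?g) q"
    using \<sigma> \<nu>(2) by (auto simp: normal_flux_def scaleR_add_right)
  also have "det (jacobian X p) *\<^sub>R ?g = adjugate_metrics X p $ b"
    by (simp add: adjugate_metrics_eq_det_inv_jacobian[OF det] row_def vec_eq_iff)
  finally show ?thesis .
qed

section \<open>Conservation and equivalence on a slab element\<close>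

lemma slab_metrics_row_1:
  assumes "slab_element l n X"
  shows "adjugate_metrics X r $ 1 $ 2 = 0" "adjugate_metrics X r $ 1 $ 3 = 0"
proof -
  have "d_xi (\<lambda>p. X p $ 1) r = 0" "d_eta (\<lambda>p. X p $ 1) r = 0"
    by (rule slab_time_deriv[OF assms]; simp)+
  then show "adjugate_metrics X r $ 1 $ 2 = 0" "adjugate_metrics X r $ 1 $ 3 = 0"
    by (simp_all add: adjugate_metrics_def Let_def jacobian_minor_def vector_3)
qed

lemma slab_metrics_tensor_poly:
  assumes "slab_element l n X"
  shows "tensor_poly (2 * n) (2 * l) (2 * l) (\<lambda>r. adjugate_metrics X r $ b $ a)"
proof -
  have "tensor_poly (2 * n) (2 * l) (2 * l) (\<lambda>r. jacobian_minor d d' (\<lambda>p. X p $ i) (\<lambda>p. X p $ j) r)"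
    for d d' i j
    by (intro tensor_poly_jacobian_minor slab_coord_tensor_poly[OF assms])
  then show ?thesis
    using exhaust_3[of a] exhaust_3[of b]
    by (auto simp: adjugate_metrics_def Let_def vector_3)
qed

lemma slab_metrics_gcl:
  assumes "slab_element l n X"
  shows "d_tau (\<lambda>r. adjugate_metrics X r $ 1 $ a) r + d_xi (\<lambda>r. adjugate_metrics X r $ 2 $ a) r
       + d_eta (\<lambda>r. adjugate_metrics X r $ 3 $ a) r = 0"
proof -
  have "d_tau (\<lambda>r. jacobian_minor 2 3 (\<lambda>p. X p $ i) (\<lambda>p. X p $ j) r) r
      + d_xi (\<lambda>r. jacobian_minor 3 1 (\<lambda>p. X p $ i) (\<lambda>p. X p $ j) r) r
      + d_eta (\<lambda>r. jacobian_minor 1 2 (\<lambda>p. X p $ i) (\<lambda>p. X p $ j) r) r = 0" for i j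
    by (rule piola_identity[OF slab_coord_tensor_poly[OF assms] slab_coord_tensor_poly[OF assms]])
  then show ?thesis
    using exhaust_3[of a] by (auto simp: adjugate_metrics_def Let_def vector_3)
qed

lemma slab_transformed_flux:
  assumes "slab_element l n X"
  shows "transformed_flux (adjugate_metrics X) Q F G b r =
    adjugate_metrics X r $ b $ 1 *\<^sub>R Q r + adjugate_metrics X r $ b $ 2 *\<^sub>R F r
    + adjugate_metrics X r $ b $ 3 *\<^sub>R G r"
  by (simp add: transformed_flux_def slab_metrics_row_1[OF assms])

text \<open>
  The terms with differentiated metrics drop out: for each of \<open>Q, F, G\<close> they collect to the
  divergence of one column of the adjugate.
\<close>

lemma divergence_transformed_flux:
  fixes Q F G :: "real^3 \<Rightarrow> real^'v"
  assumes slab: "slab_element l n X"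
    and diff: "\<And>b. coord_differentiable b Q r" "\<And>b. coord_differentiable b F r"
      "\<And>b. coord_differentiable b G r"
  defines "A \<equiv> adjugate_metrics X"
  shows "divergence (transformed_flux A Q F G) r =
    (A r $ 1 $ 1 *\<^sub>R d_tau Q r + A r $ 2 $ 1 *\<^sub>R d_xi Q r + A r $ 3 $ 1 *\<^sub>R d_eta Q r) +
    (A r $ 2 $ 2 *\<^sub>R d_xi F r + A r $ 3 $ 2 *\<^sub>R d_eta F r) +
    (A r $ 2 $ 3 *\<^sub>R d_xi G r + A r $ 3 $ 3 *\<^sub>R d_eta G r)"
proof -
  have A: "coord_differentiable b (\<lambda>r. A r $ c $ a) r" for a b c
    unfolding A_def by (rule tensor_poly_coord_differentiable[OF slab_metrics_tensor_poly[OF slab]])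
  have flux: "transformed_flux A Q F G b = (\<lambda>r. A r $ b $ 1 *\<^sub>R Q r + A r $ b $ 2 *\<^sub>R F r + A r $ b $ 3 *\<^sub>R G r)"
    for b unfolding A_def by (rule ext) (rule slab_transformed_flux[OF slab])
  have deriv: "partial_deriv b (transformed_flux A Q F G b) r =
      A r $ b $ 1 *\<^sub>R partial_deriv b Q r + A r $ b $ 2 *\<^sub>R partial_deriv b F r
      + A r $ b $ 3 *\<^sub>R partial_deriv b G r
      + partial_deriv b (\<lambda>r. A r $ b $ 1) r *\<^sub>R Q r + partial_deriv b (\<lambda>r. A r $ b $ 2) r *\<^sub>R F r
      + partial_deriv b (\<lambda>r. A r $ b $ 3) r *\<^sub>R G r" for b
    unfolding flux
    by (simp add: partial_deriv_add partial_deriv_scaleR A diff)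
  have gcl: "d_tau (\<lambda>r. A r $ 1 $ a) r *\<^sub>R v + d_xi (\<lambda>r. A r $ 2 $ a) r *\<^sub>R v
       + d_eta (\<lambda>r. A r $ 3 $ a) r *\<^sub>R v = 0" for a and v :: "real^'v"
    using slab_metrics_gcl[OF slab] by (simp add: A_def flip: scaleR_add_left)
  have "divergence (transformed_flux A Q F G) r =
    (A r $ 1 $ 1 *\<^sub>R d_tau Q r + A r $ 2 $ 1 *\<^sub>R d_xi Q r + A r $ 3 $ 1 *\<^sub>R d_eta Q r) +
    (A r $ 2 $ 2 *\<^sub>R d_xi F r + A r $ 3 $ 2 *\<^sub>R d_eta F r) +
    (A r $ 2 $ 3 *\<^sub>R d_xi G r + A r $ 3 $ 3 *\<^sub>R d_eta G r)
    + (d_tau (\<lambda>r. A r $ 1 $ 1) r *\<^sub>R Q r + d_xi (\<lambda>r. A r $ 2 $ 1) r *\<^sub>R Q r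
       + d_eta (\<lambda>r. A r $ 3 $ 1) r *\<^sub>R Q r)
    + (d_tau (\<lambda>r. A r $ 1 $ 2) r *\<^sub>R F r + d_xi (\<lambda>r. A r $ 2 $ 2) r *\<^sub>R F r
       + d_eta (\<lambda>r. A r $ 3 $ 2) r *\<^sub>R F r)
    + (d_tau (\<lambda>r. A r $ 1 $ 3) r *\<^sub>R G r + d_xi (\<lambda>r. A r $ 2 $ 3) r *\<^sub>R G r
       + d_eta (\<lambda>r. A r $ 3 $ 3) r *\<^sub>R G r)"
    unfolding divergence_def deriv
    by (simp add: A_def slab_metrics_row_1[OF slab] ac_simps)
  then show ?thesis by (simp add: gcl)
qed

text \<open>
  The sums in the discrete conservation law are derivatives of interpolants, hence of the
  interpolated polynomials themselves.
\<close>

lemma sum_nodal_basis_partial_deriv: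
  assumes "tensor_poly (d 1) (d 2) (d 3) f" and "\<And>c. d c < N c"
  shows "(\<Sum>p\<in>sol_points N. f p * partial_deriv b (nodal_basis N p) r) = partial_deriv b f r"
proof -
  have "f = (\<lambda>r. \<Sum>p\<in>sol_points N. nodal_basis N p r *\<^sub>R f p)"
    using nodal_interp_exact[OF assms] by (simp add: nodal_interp_def fun_eq_iff)
  then have "partial_deriv b f r
      = partial_deriv b (\<lambda>r. \<Sum>p\<in>sol_points N. nodal_basis N p r *\<^sub>R f p) r"
    by simp
  also have "\<dots> = (\<Sum>p\<in>sol_points N. f p * partial_deriv b (nodal_basis N p) r)"
    by (simp only: partial_deriv_sum partial_deriv_scaleR partial_deriv_const
        coord_differentiable_nodal_basis) (simp add: mult.commute)
  finally show ?thesis ..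
qed

text \<open>
  In a freestream the jump of the flux at each face is zero as a polynomial, not only at the flux
  points: both the transformed flux and the interpolated numerical flux are reproduced exactly.
\<close>

lemma slab_gcl:
  fixes F G :: "real^'v \<Rightarrow> real^'v"
  assumes slab: "slab_element l n X"
    and N: "2 * n < N 1" "2 * l < N 2" "2 * l < N 3"
  shows "numerically_satisfies_gcl N X (adjugate_metrics X) F G speed"
  unfolding numerically_satisfies_gcl_def
proof (intro conjI allI)
  let ?A = "adjugate_metrics X"
  define d where "d c = (if c = 1 then 2 * n else 2 * l)" for c :: 3
  have d_less: "d c < N c" for c
    using N exhaust_3[of c] by (auto simp: d_def)
  have A: "tensor_poly (d 1) (d 2) (d 3) (\<lambda>r. ?A r $ b $ a)" for a b
    using slab_metrics_tensor_poly[OF slab] by (simp add: d_def)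
  show "(\<Sum>p\<in>sol_points N. ?A p $ 1 $ a * d_tau (nodal_basis N p) r) +
        (\<Sum>p\<in>sol_points N. ?A p $ 2 $ a * d_xi (nodal_basis N p) r) +
        (\<Sum>p\<in>sol_points N. ?A p $ 3 $ a * d_eta (nodal_basis N p) r) = 0" for a r
    by (simp add: sum_nodal_basis_partial_deriv[OF A d_less] slab_metrics_gcl[OF slab])
  show "divergence (freestream_flux N ?A F G q) r +
        correction_field N (freestream_flux N ?A F G q)
          (numerical_flux X F G speed (\<lambda>_. q) (\<lambda>_ _ _. q)) r = 0" for q r
  proof -
    define H where "H = transformed_flux ?A (\<lambda>_. q) (\<lambda>_. F q) (\<lambda>_. G q)"
    have H_eq: "H b r = normal_flux F G (?A r $ b) q" for b r
      by (simp add: H_def slab_transformed_flux[OF slab] normal_flux_def)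
    have tp: "tensor_poly (d 1) (d 2) (d 3) (\<lambda>r. ?A r $ b $ a *\<^sub>R v)" for a b and v :: "real^'v"
      using tensor_poly_scaleR[OF A tensor_poly_const[of 0 0 0 v]] by simp
    have H: "tensor_poly (d 1) (d 2) (d 3) (H b)" for b
      unfolding H_eq[abs_def] normal_flux_def by (intro tensor_poly_add tp)
    have free: "freestream_flux N ?A F G q = H"
      by (intro ext) (simp add: freestream_flux_def nodal_interp_exact[OF H d_less, unfolded H_def] H_def)
    have "face_interp N b \<sigma> (numerical_flux X F G speed (\<lambda>_. q) (\<lambda>_ _ _. q) b \<sigma>) r
        = H b (set_coord b \<sigma> r)" if "\<sigma> = -1 \<or> \<sigma> = 1" for b \<sigma> r
    proof -
      have "numerical_flux X F G speed (\<lambda>_. q) (\<lambda>_ _ _. q) b \<sigma> p = H b p"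
        if "p \<in> flux_points N b \<sigma>" for p
        using flux_points_in_ref_cube[OF \<open>\<sigma> = -1 \<or> \<sigma> = 1\<close> that] slab
        unfolding H_eq
        by (intro numerical_flux_freestream) (auto simp: slab_element_def \<open>\<sigma> = -1 \<or> \<sigma> = 1\<close>)
      then have "face_interp N b \<sigma> (numerical_flux X F G speed (\<lambda>_. q) (\<lambda>_ _ _. q) b \<sigma>) r
          = face_interp N b \<sigma> (H b) r"
        by (simp add: face_interp_def)
      then show ?thesis by (simp add: face_interp_exact[OF H d_less])
    qed
    then have "correction_flux N H (numerical_flux X F G speed (\<lambda>_. q) (\<lambda>_ _ _. q)) = (\<lambda>b r. 0)"
      by (simp add: correction_flux_def fun_eq_iff)
    then have "correction_field N H (numerical_flux X F G speed (\<lambda>_. q) (\<lambda>_ _ _. q)) r = 0"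
      by (simp add: correction_field_def divergence_def partial_deriv_const)
    moreover have "divergence H r = 0"
      unfolding H_def
      by (simp add: divergence_transformed_flux[OF slab] partial_deriv_const)
    ultimately show ?thesis by (simp add: free)
  qed
qed

text \<open>
  The pseudo-time derivative and the correction field differ between the two forms by the factor
  \<open>det J\<close>, which does not depend on the pseudo-time; only the divergence needs an argument.
\<close>

lemma slab_numerically_equivalent:
  fixes Q F G :: "real^3 \<Rightarrow> real^'v"
  assumes slab: "slab_element l n X"
    and Qh: "\<And>r. (\<lambda>u. Qh u r) differentiable (at s)"
    and diff: "\<And>b r. coord_differentiable b Q r" "\<And>b r. coord_differentiable b F r"
      "\<And>b r. coord_differentiable b G r"
  shows "numerically_equivalent N X (adjugate_metrics X) Qh Q F G \<delta> s"
  unfolding numerically_equivalent_def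
proof (intro ballI conjI)
  fix r assume "r \<in> sol_points N"
  then have det: "det (jacobian X r) \<noteq> 0"
    using slab sol_points_in_ref_cube by (auto simp: slab_element_def)
  show div: "det (jacobian X r) *\<^sub>R physical_divergence X Q F G r =
      divergence (transformed_flux (adjugate_metrics X) Q F G) r"
    by (simp add: divergence_transformed_flux[OF slab diff] physical_divergence_def Let_def
        adjugate_metrics_eq_det_inv_jacobian[OF det] scaleR_add_right)
  have "((\<lambda>u. Qh u r) has_vector_derivative vector_derivative (\<lambda>u. Qh u r) (at s)) (at s)"
    using Qh by (simp flip: vector_derivative_works)
  then have "vector_derivative (\<lambda>u. det (jacobian X r) *\<^sub>R Qh u r) (at s)
      = det (jacobian X r) *\<^sub>R vector_derivative (\<lambda>u. Qh u r) (at s)"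
    by (intro vector_derivative_at bounded_linear.has_vector_derivative[OF bounded_linear_scaleR_right])
  then show "reference_lhs X (adjugate_metrics X) Qh Q F G \<delta> s r =
      det (jacobian X r) *\<^sub>R physical_lhs X Qh Q F G \<delta> s r"
    using det by (simp add: reference_lhs_def physical_lhs_def scaleR_add_right flip: div)
qed

theorem theorem3:
  fixes l n m k :: nat
    and X :: "real^3 \<Rightarrow> real^3"
    and M :: "real^3 \<Rightarrow> real^3^3"
    and F G :: "real^'v \<Rightarrow> real^'v"
    and speed :: "real^3 \<Rightarrow> real^'v \<Rightarrow> real^'v \<Rightarrow> real"
  assumes "l \<ge> 1" and "n \<ge> 1" and "k \<ge> 1"
    and "slab_element l n X"
    and "M = nonconservative_metrics X \<or> M = conservative_metrics X"
  defines "N \<equiv> num_points k l m n"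
  shows "numerically_satisfies_gcl N X M F G speed \<and>
    (\<forall>(Qh :: real \<Rightarrow> real^3 \<Rightarrow> real^'v) Qloc Floc Gloc Qext s.
       (\<forall>s'. tensor_poly m k k (Qh s')) \<longrightarrow>
       (\<forall>r s'. (\<lambda>u. Qh u r) differentiable (at s')) \<longrightarrow>
       tensor_poly (m + n) k k Qloc \<longrightarrow>
       tensor_poly (m + n) (k + l) (k + l) Floc \<longrightarrow>
       tensor_poly (m + n) (k + l) (k + l) Gloc \<longrightarrow>
       numerically_equivalent N X M Qh Qloc Floc Gloc
         (correction_field N (transformed_flux M Qloc Floc Gloc)
            (numerical_flux X F G speed (Qh s) Qext)) s)"
proof -
  have M: "M = adjugate_metrics X"
    using assms(4,5) slab_metrics_eq_adjugate_metrics by metis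
  have "numerically_satisfies_gcl N X M F G speed"
    unfolding M using assms(1-3)
    by (intro slab_gcl[OF assms(4)]) (simp_all add: N_def num_points_def)
  then show ?thesis
    unfolding M
    by (auto intro!: slab_numerically_equivalent[OF assms(4)] intro: tensor_poly_coord_differentiable)
qed

end
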